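(* Let $p_1,p_2<1$ and let $U_i(x)=\frac{1}{p_i}x^{p_i}$ for $i=1,2$ (with $U_i(x)=\ln x$ if $p_i=0$). Define $q_i:=\frac{p_i}{p_i-1}<1$ and $\lambda_i:=\lambda(q_i)$, $i=1,2$. Let $A(x,t)$ and $C(x,t)$ be the optimal amount invested in the risky asset and the optimal consumption rate at wealth $x$ with time horizon $t$. Then, for every $x>0$: 1. If $q_1<q^*$ or $q_2\le q^*$, then $$\lim_{t\to\infty}A(x,t)=\frac{\theta}{\sigma}\,(1-\min\{q_1,q_2\})\,x,\qquad \lim_{t\to\infty}R(t)\,C(x,t)=x^{\frac{q_2-1}{\min\{q_1,q_2\}-1}},$$ where $$R(t)=\begin{cases} e^{\lambda_1 t}+\dfrac{e^{\lambda_2 t}-1}{\lambda_2}, & q_1=q_2,\\[2mm] e^{\frac{q_2-1}{q_1-1}\lambda_1 t}, & q_1<q_2,\\[2mm] \dfrac{e^{\lambda_2 t}-1}{\lambda_2}, & q_1>q_2,\end{cases}$$ and $(e^{\lambda_2 t}-1)/\lambda_2$ is read as $t$ if $\lambda_2=0$. 2. If $q_1>q^*$ and $q_2>q^*$, then $$\lim_{t\to\infty}A(x,t)=\frac{\theta}{\sigma}(1-q_2)x,\qquad \lim_{t\to\infty}C(x,t)=-\lambda_2 x.$$ 3. If $q_1=q^*$ and $q_2>q^*$, then $$\lim_{t\to\infty}A(x,t)=\frac{\theta}{\sigma}\Big[(1-q_1)Y^{q_1-1}-(1-q_2)\frac{1}{\lambda_2}Y^{q_2-1}\Big],\qquad \lim_{t\to\infty}C(x,t)=Y^{q_2-1},$$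 where $Y$ is the unique solution $y>0$ of the equation $y^{q_1-1}-\frac{1}{\lambda_2}y^{q_2-1}=x$.
   Context: Market and problem. Let $r>0$ (riskless rate), $\delta>0$ (discount rate), $\mu>0$, $\sigma>0$ be constants, $\theta=\sigma^{-1}(\mu-r)\neq0$ (Sharpe ratio), and $W$ a standard Brownian motion. Wealth satisfies $dX_s=rX_s\,ds+X_s\pi_s\sigma(\theta\,ds+dW_s)-c_s\,ds$, where $\pi_s$ is the proportion of wealth in the risky asset and $c_s\ge0$ is the consumption rate. The agent maximizes $E\big[\int_0^T e^{-\delta s}U_2(c_s)\,ds+e^{-\delta T}U_1(X_T)\big]$ over $(\pi,c)$. The variable $t$ denotes the time horizon (time remaining to the terminal date), so the distant-horizon limit is $t\to\infty$. Dual functions: $V_i(y)=\sup_{x\ge0}\{U_i(x)-xy\}$, $y>0$. For the power utilities of the claim, $V_i'(y)=-y^{q_i-1}$. Constants: $\alpha=\frac12+\frac{r-\delta}{\theta^2}$, $a=\frac{\theta}{\sqrt2}$, $\beta=-a^2\alpha^2-\delta$, and for $q<1$ $$\lambda(q)=\beta+(\alpha-q)^2a^2=\tfrac12\theta^2q(q-1)-rq+\delta(q-1).$$ The threshold $q^*=\alpha-\sqrt{\alpha^2+2\delta/\theta^2}<0$ is the unique root of $\lambda$ in $(-\infty,1)$; $\lambda>0$ on $(-\infty,q^* )$ and $\lambda<0$ on $(q^*,1)$. Optimal strategies. For $y>0$, $t>0$ (with $\pi$ in the next formula the number $3.14\ldots$) let $$I_i(y,t)=\frac{e^{\beta t}}{2\sqrt{\pi}}\int_{-\infty}^\infty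 e^{-\frac{\eta^2}{4}-(\alpha-1)a\sqrt t\,\eta}\,\big|V_i'(ye^{a\sqrt t\,\eta})\big|\,d\eta,\qquad v_y(y,t)=-I_1(y,t)-\int_0^tI_2(y,\tau)\,d\tau .$$ For $x>0$, $t>0$, let $y=y(x,t)>0$ be the unique solution of $x=-v_y(y,t)$. The optimal amount of money in the risky asset and the optimal consumption rate at wealth $x$ with horizon $t$ are $$A(x,t)=\frac{\theta}{\sigma}\,y\,v_{yy}(y,t),\qquad C(x,t)=-V_2'(y),\qquad y=y(x,t),$$ where $v_{yy}=\partial_y v_y$. *)

theory Defs
  imports "HOL-Analysis.Analysis"
begin

text \<open>
  Utilities take values in the extended reals because \<open>U 0 = -\<infinity>\<close> for exponents \<open>p \<le> 0\<close>
  (whereas \<open>0 powr p = 0\<close> and \<open>ln 0 = 0\<close> in HOL). They are only used on \<open>x \<ge> 0\<close>.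
\<close>

definition power_utility :: "real \<Rightarrow> real \<Rightarrow> ereal" where
  "power_utility p x =
     (if x = 0 \<and> p \<le> 0 then -\<infinity>
      else if p = 0 then ereal (ln x)
      else ereal (1 / p * x powr p))"

text \<open>
  The supremum is taken in \<open>ereal\<close>; it is finite for the utilities above whenever \<open>y > 0\<close>
  and \<open>p < 1\<close>, so that \<open>real_of_ereal\<close> loses nothing there.
\<close>

definition dual_utility :: "(real \<Rightarrow> ereal) \<Rightarrow> real \<Rightarrow> real" where
  "dual_utility U y = real_of_ereal (SUP x\<in>{0..}. U x - ereal (x * y))"

definition const_alpha :: "real \<Rightarrow> real \<Rightarrow> real \<Rightarrow> real" where
  "const_alpha r \<delta> \<theta> = 1 / 2 + (r - \<delta>) / \<theta>\<^sup>2"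

definition const_a :: "real \<Rightarrow> real" where
  "const_a \<theta> = \<theta> / sqrt 2"

definition const_beta :: "real \<Rightarrow> real \<Rightarrow> real \<Rightarrow> real" where
  "const_beta r \<delta> \<theta> = - (const_a \<theta>)\<^sup>2 * (const_alpha r \<delta> \<theta>)\<^sup>2 - \<delta>"

definition lambda :: "real \<Rightarrow> real \<Rightarrow> real \<Rightarrow> real \<Rightarrow> real" where
  "lambda r \<delta> \<theta> q = const_beta r \<delta> \<theta> + (const_alpha r \<delta> \<theta> - q)\<^sup>2 * (const_a \<theta>)\<^sup>2"

definition q_star :: "real \<Rightarrow> real \<Rightarrow> real \<Rightarrow> real" where
  "q_star r \<delta> \<theta> = const_alpha r \<delta> \<theta> - sqrt ((const_alpha r \<delta> \<theta>)\<^sup>2 + 2 * \<delta> / \<theta>\<^sup>2)"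

definition dual_I :: "real \<Rightarrow> real \<Rightarrow> real \<Rightarrow> (real \<Rightarrow> ereal) \<Rightarrow> real \<Rightarrow> real \<Rightarrow> real" where
  "dual_I r \<delta> \<theta> U y t =
     exp (const_beta r \<delta> \<theta> * t) / (2 * sqrt pi) *
     (LINT \<eta>|lborel.
        exp (- (\<eta>\<^sup>2 / 4) - (const_alpha r \<delta> \<theta> - 1) * const_a \<theta> * sqrt t * \<eta>) *
        \<bar>deriv (dual_utility U) (y * exp (const_a \<theta> * sqrt t * \<eta>))\<bar>)"

text \<open>
  \<open>U1\<close> is the utility of terminal wealth, \<open>U2\<close> that of consumption, and \<open>t\<close> the time
  remaining to the terminal date. \<open>dual_vy\<close> is the derivative \<open>v\<^sub>y\<close> of the dual value function.
\<close>

definition dual_vy ::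
  "real \<Rightarrow> real \<Rightarrow> real \<Rightarrow> (real \<Rightarrow> ereal) \<Rightarrow> (real \<Rightarrow> ereal) \<Rightarrow> real \<Rightarrow> real \<Rightarrow> real" where
  "dual_vy r \<delta> \<theta> U1 U2 y t =
     - dual_I r \<delta> \<theta> U1 y t - (LINT \<tau>:{0..t}|lborel. dual_I r \<delta> \<theta> U2 y \<tau>)"

definition dual_point ::
  "real \<Rightarrow> real \<Rightarrow> real \<Rightarrow> (real \<Rightarrow> ereal) \<Rightarrow> (real \<Rightarrow> ereal) \<Rightarrow> real \<Rightarrow> real \<Rightarrow> real" where
  "dual_point r \<delta> \<theta> U1 U2 x t = (THE y. y > 0 \<and> x = - dual_vy r \<delta> \<theta> U1 U2 y t)"

definition optimal_amount ::
  "real \<Rightarrow> real \<Rightarrow> real \<Rightarrow> real \<Rightarrow> (real \<Rightarrow> ereal) \<Rightarrow> (real \<Rightarrow> ereal) \<Rightarrow> real \<Rightarrow> real \<Rightarrow> real" where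
  "optimal_amount r \<delta> \<theta> \<sigma> U1 U2 x t =
     (let y = dual_point r \<delta> \<theta> U1 U2 x t
      in \<theta> / \<sigma> * y * deriv (\<lambda>z. dual_vy r \<delta> \<theta> U1 U2 z t) y)"

definition optimal_consumption ::
  "real \<Rightarrow> real \<Rightarrow> real \<Rightarrow> (real \<Rightarrow> ereal) \<Rightarrow> (real \<Rightarrow> ereal) \<Rightarrow> real \<Rightarrow> real \<Rightarrow> real" where
  "optimal_consumption r \<delta> \<theta> U1 U2 x t =
     - deriv (dual_utility U2) (dual_point r \<delta> \<theta> U1 U2 x t)"

definition growth_factor :: "real \<Rightarrow> real \<Rightarrow> real" where
  "growth_factor l t = (if l = 0 then t else (exp (l * t) - 1) / l)"

definition rate_R :: "real \<Rightarrow> real \<Rightarrow> real \<Rightarrow> real \<Rightarrow> real \<Rightarrow> real" where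
  "rate_R q1 q2 l1 l2 t =
     (if q1 = q2 then exp (l1 * t) + growth_factor l2 t
      else if q1 < q2 then exp ((q2 - 1) / (q1 - 1) * l1 * t)
      else growth_factor l2 t)"

end

theory Submission
  imports Defs "HOL-Probability.Distributions" "HOL-Real_Asymp.Real_Asymp"
begin

text \<open>
  For power utilities the Gaussian integrals are explicit, and the dual point \<open>y = y(x,t)\<close> solves
  \<open>u + w = x\<close> with \<open>u = E(t) y powr (q1 - 1)\<close> and \<open>w = G(t) y powr (q2 - 1)\<close>, where
  \<open>E(t) = exp (\<lambda>1 t)\<close> and \<open>G(t)\<close> is the integral of \<open>exp (\<lambda>2 \<tau>)\<close> over \<open>0 \<le> \<tau> \<le> t\<close>; moreover
  \<open>A = (\<theta>/\<sigma>) ((1 - q1) u + (1 - q2) w)\<close> and \<open>C = w/G\<close>.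
  Since \<open>w \<le> x\<close> bounds \<open>y\<close> from below, it bounds \<open>u\<close> by a constant times
  \<open>E(t) G(t) powr - k\<close> with \<open>k = (1 - q1)/(1 - q2)\<close>, and symmetrically for \<open>w\<close>. Which of the
  two terms vanishes in the limit is decided by the strict monotonicity of \<open>\<lambda>(q)/(1 - q)\<close>. In the
  borderline case \<open>\<lambda>1 = 0 > \<lambda>2\<close> neither vanishes, and \<open>y\<close> converges to the root of the limit
  equation.
\<close>

section \<open>Power utilities and their dual functions\<close>

text \<open>The finite branches of \<open>power_utility\<close>, kept real-valued so that they can
  be differentiated; the two functions agree at positive arguments.\<close>

definition real_power_utility :: "real \<Rightarrow> real \<Rightarrow> real" where
  "real_power_utility p x = (if p = 0 then ln x else 1 / p * x powr p)"

lemma real_power_utility_deriv: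
  assumes "x > 0"
  shows "(real_power_utility p has_real_derivative x powr (p - 1)) (at x)"
proof (cases "p = 0")
  case True
  then have "real_power_utility p = ln"
    by (simp add: real_power_utility_def fun_eq_iff)
  with True assms show ?thesis
    by (auto intro!: derivative_eq_intros simp: powr_minus_divide)
next
  case False
  then have "real_power_utility p = (\<lambda>x. 1 / p * x powr p)"
    by (simp add: real_power_utility_def fun_eq_iff)
  moreover have "((\<lambda>x. 1 / p * x powr p) has_real_derivative 1 / p * (p * x powr (p - 1))) (at x)"
    by (intro DERIV_cmult has_real_derivative_powr assms)
  ultimately show ?thesis
    using False by simp
qed

text \<open>This is the first-order condition: for the price \<open>z powr (p - 1)\<close> the
  maximiser over positive wealth is \<open>z\<close>. By the mean value theorem the difference of
  the two sides has the sign dictated by the marginal utility, which decreases because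
  \<open>p < 1\<close>.\<close>

lemma real_power_utility_le:
  assumes "p < 1" "x > 0" "z > 0"
  shows "real_power_utility p x - x * z powr (p - 1)
       \<le> real_power_utility p z - z * z powr (p - 1)"
proof -
  let ?f = "\<lambda>s. real_power_utility p s - s * z powr (p - 1)"
  have D: "(?f has_real_derivative s powr (p - 1) - z powr (p - 1)) (at s)" if "s > 0" for s
    using that by (auto intro!: derivative_eq_intros real_power_utility_deriv)
  consider "x = z" | "x < z" | "z < x" by linarith
  then show ?thesis
  proof cases
    case 2
    obtain s where s: "s > x" "s < z" "?f z - ?f x = (z - x) * (s powr (p - 1) - z powr (p - 1))"
      using MVT2[OF 2, of ?f "\<lambda>s. s powr (p - 1) - z powr (p - 1)"] D assms by force
    have "s powr (p - 1) \<ge> z powr (p - 1)"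
      using s assms by (intro powr_mono2') auto
    then have "(z - x) * (s powr (p - 1) - z powr (p - 1)) \<ge> 0"
      using 2 by (intro mult_nonneg_nonneg) auto
    with s show ?thesis by linarith
  next
    case 3
    obtain s where s: "s > z" "s < x" "?f x - ?f z = (x - z) * (s powr (p - 1) - z powr (p - 1))"
      using MVT2[OF 3, of ?f "\<lambda>s. s powr (p - 1) - z powr (p - 1)"] D assms by force
    have "s powr (p - 1) \<le> z powr (p - 1)"
      using s assms by (intro powr_mono2') auto
    then have "(x - z) * (s powr (p - 1) - z powr (p - 1)) \<le> 0"
      using 3 by (intro mult_nonneg_nonpos) auto
    with s show ?thesis by linarith
  qed simp
qed

text \<open>The supremum is attained at the point \<open>z\<close> where the marginal utility equals
  \<open>y\<close>. The boundary point 0 is compared separately, since the derivative argument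
  covers only positive arguments.\<close>

lemma dual_power_utility:
  assumes "p < 1" "y > 0"
  defines "z \<equiv> y powr (1 / (p - 1))"
  shows "dual_utility (power_utility p) y = real_power_utility p z - z * y"
proof -
  have z: "z > 0" and zy: "z powr (p - 1) = y"
    using assms by (auto simp: z_def powr_powr)
  have "z * y = z powr p"
    using z unfolding zy[symmetric] by (simp add: powr_mult_base)
  have "(SUP x\<in>{0..}. power_utility p x - ereal (x * y)) = ereal (real_power_utility p z - z * y)"
  proof (rule antisym)
    show "(SUP x\<in>{0..}. power_utility p x - ereal (x * y)) \<le> ereal (real_power_utility p z - z * y)"
    proof (rule SUP_least)
      fix x :: real
      assume "x \<in> {0..}"
      then consider "x > 0" | "x = 0" "p \<le> 0" | "x = 0" "p > 0" by force
      then show "power_utility p x - ereal (x * y) \<le> ereal (real_power_utility p z - z * y)"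
      proof cases
        case 1
        then have "power_utility p x = ereal (real_power_utility p x)"
          by (simp add: power_utility_def real_power_utility_def)
        with real_power_utility_le[OF \<open>p < 1\<close> 1 z] show ?thesis
          by (simp add: zy)
      next
        case 2
        then show ?thesis by (simp add: power_utility_def)
      next
        case 3
        \<comment> \<open>At 0 the objective is 0, while at \<open>z\<close> it equals
          \<open>(1 / p - 1) * z powr p\<close>, which is nonnegative for
          \<open>0 < p < 1\<close>.\<close>
        have "1 * z powr p \<le> 1 / p * z powr p"
          using 3 \<open>p < 1\<close> by (intro mult_right_mono) auto
        with 3 \<open>z * y = z powr p\<close> show ?thesis
          by (simp add: power_utility_def real_power_utility_def)
      qed
    qed
  next
    have "ereal (real_power_utility p z - z * y) = power_utility p z - ereal (z * y)"
      using z by (simp add: power_utility_def real_power_utility_def)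
    also have "\<dots> \<le> (SUP x\<in>{0..}. power_utility p x - ereal (x * y))"
      using z by (intro SUP_upper) auto
    finally show "ereal (real_power_utility p z - z * y) \<le> \<dots>" .
  qed
  then show ?thesis
    by (simp add: dual_utility_def)
qed

text \<open>
  By the envelope theorem the derivative is minus the maximiser; this also treats the
  logarithmic case \<open>p = 0\<close> uniformly.
\<close>

lemma deriv_dual_power_utility:
  assumes "p < 1" "y > 0"
  shows "deriv (dual_utility (power_utility p)) y = - (y powr (p / (p - 1) - 1))"
proof -
  define k where "k = 1 / (p - 1)"
  have k: "k * (p - 1) = 1" "k = p / (p - 1) - 1"
    using assms by (auto simp: k_def field_simps)
  let ?D = "k * y powr (k - 1)"
  have z: "((\<lambda>y. y powr k) has_real_derivative ?D) (at y)"
    using assms by (intro has_real_derivative_powr)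
  have "((\<lambda>y. real_power_utility p (y powr k)) has_real_derivative
           (y powr k) powr (p - 1) * ?D) (at y)"
    by (rule DERIV_chain2[OF real_power_utility_deriv z]) (use assms in auto)
  then have "((\<lambda>y. real_power_utility p (y powr k) - y powr k * y) has_real_derivative
           (y powr k) powr (p - 1) * ?D - (?D * y + 1 * y powr k)) (at y)"
    by (intro DERIV_diff DERIV_mult z DERIV_ident)
  \<comment> \<open>Marginal utility at the maximiser is \<open>y\<close>, so the two terms
    containing \<open>?D\<close> cancel.\<close>
  moreover have "(y powr k) powr (p - 1) = y"
    using assms k by (simp add: powr_powr)
  ultimately have D: "((\<lambda>y. real_power_utility p (y powr k) - y powr k * y) has_real_derivative
           - (y powr k)) (at y)"
    by (simp add: mult.commute)
  have ev: "eventually (\<lambda>y. dual_utility (power_utility p) y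
      = real_power_utility p (y powr k) - y powr k * y) (nhds y)"
    using eventually_nhds_in_open[of "{0<..}" y] assms
    by (auto elim!: eventually_mono simp: dual_power_utility k_def)
  have "(dual_utility (power_utility p) has_real_derivative - (y powr k)) (at y)"
    by (rule DERIV_cong_ev[OF refl ev refl, THEN iffD2, OF D])
  then show ?thesis
    by (simp add: DERIV_imp_deriv k(2))
qed

section \<open>Closed forms of the Gaussian integrals\<close>

text \<open>Completing the square turns the integrand into a multiple of the normal density with
  mean \<open>2 * b\<close> and variance 2.\<close>

lemma gaussian_integral_tilted:
  fixes b :: real
  shows "(LINT \<eta>|lborel. exp (b * \<eta> - \<eta>\<^sup>2 / 4)) = 2 * sqrt pi * exp (b\<^sup>2)"
proof -
  have "exp (b * \<eta> - \<eta>\<^sup>2 / 4) = 2 * sqrt pi * exp (b\<^sup>2) * normal_density (2 * b) (sqrt 2) \<eta>" for \<eta>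
  proof -
    have "b * \<eta> - \<eta>\<^sup>2 / 4 = b\<^sup>2 + - (\<eta> - 2 * b)\<^sup>2 / 4"
      by (simp add: power2_eq_square field_simps)
    then have "exp (b * \<eta> - \<eta>\<^sup>2 / 4) = exp (b\<^sup>2) * exp (- (\<eta> - 2 * b)\<^sup>2 / 4)"
      by (simp only: exp_add)
    then show ?thesis
      by (simp add: normal_density_def real_sqrt_mult)
  qed
  then show ?thesis
    by (simp add: integral_normal_density)
qed

text \<open>The marginal dual factorises into \<open>y powr (q - 1)\<close> and an exponential in
  \<open>\<eta>\<close>. The latter combines with the given tilt to the coefficient
  \<open>(q - \<alpha>) * s\<close>, whose square is
  \<open>(\<alpha> - q)\<^sup>2 * (const_a \<theta>)\<^sup>2 * t\<close>; adding
  \<open>const_beta r \<delta> \<theta> * t\<close> gives the exponent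
  \<open>lambda r \<delta> \<theta> q * t\<close>.\<close>

lemma dual_I_power_utility:
  assumes "p < 1" "y > 0" "t \<ge> 0"
  defines "q \<equiv> p / (p - 1)"
  shows "dual_I r \<delta> \<theta> (power_utility p) y t = y powr (q - 1) * exp (lambda r \<delta> \<theta> q * t)"
proof -
  define s where "s = const_a \<theta> * sqrt t"
  define \<alpha> where "\<alpha> = const_alpha r \<delta> \<theta>"
  have "exp (- (\<eta>\<^sup>2 / 4) - (\<alpha> - 1) * const_a \<theta> * sqrt t * \<eta>) *
        \<bar>deriv (dual_utility (power_utility p)) (y * exp (const_a \<theta> * sqrt t * \<eta>))\<bar>
      = y powr (q - 1) * exp (- (\<eta>\<^sup>2 / 4) + (q - \<alpha>) * s * \<eta>)" for \<eta>
  proof -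
    have "\<bar>deriv (dual_utility (power_utility p)) (y * exp (s * \<eta>))\<bar>
        = y powr (q - 1) * exp ((q - 1) * (s * \<eta>))"
      using assms by (simp add: deriv_dual_power_utility powr_mult exp_powr_real mult.commute)
    moreover have "- (\<eta>\<^sup>2 / 4) + (q - \<alpha>) * s * \<eta>
        = - (\<eta>\<^sup>2 / 4) - (\<alpha> - 1) * s * \<eta> + (q - 1) * (s * \<eta>)"
      by (simp add: algebra_simps)
    moreover have "(\<alpha> - 1) * const_a \<theta> * sqrt t * \<eta> = (\<alpha> - 1) * s * \<eta>"
      by (simp add: s_def)
    ultimately show ?thesis
      by (simp only: exp_add s_def[symmetric] mult.left_commute)
  qed
  then have "dual_I r \<delta> \<theta> (power_utility p) y t
      = exp (const_beta r \<delta> \<theta> * t) * (y powr (q - 1) * exp (((q - \<alpha>) * s)\<^sup>2))"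
    unfolding dual_I_def \<alpha>_def[symmetric] by (simp add: gaussian_integral_tilted)
  moreover have "((q - \<alpha>) * s)\<^sup>2 = (\<alpha> - q)\<^sup>2 * (const_a \<theta>)\<^sup>2 * t"
    using assms by (simp add: s_def power_mult_distrib power2_commute)
  ultimately show ?thesis
    by (simp add: lambda_def \<alpha>_def distrib_right exp_add)
qed

lemma integral_exp_growth_factor:
  assumes "t \<ge> 0"
  shows "(LINT \<tau>:{0..t}|lborel. exp (l * \<tau>)) = growth_factor l t"
proof (cases "l = 0")
  case True
  with assms show ?thesis
    by (simp add: growth_factor_def set_lebesgue_integral_def)
next
  case False
  have "(LINT \<tau>:{0..t}|lborel. exp (l * \<tau>)) = exp (l * t) / l - exp (l * 0) / l"
    unfolding set_lebesgue_integral_def using assms False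
    by (intro integral_FTC_atLeastAtMost)
      (auto intro!: derivative_eq_intros continuous_intros
        simp: has_real_derivative_iff_has_vector_derivative[symmetric])
  with False show ?thesis
    by (simp add: growth_factor_def diff_divide_distrib)
qed

lemma growth_factor_pos:
  assumes "t > 0"
  shows "growth_factor l t > 0"
  using assms by (auto simp: growth_factor_def zero_less_divide_iff mult_less_0_iff)

lemma dual_vy_power_utility:
  assumes "p1 < 1" "p2 < 1" "y > 0" "t \<ge> 0"
  defines "q1 \<equiv> p1 / (p1 - 1)" and "q2 \<equiv> p2 / (p2 - 1)"
  shows "dual_vy r \<delta> \<theta> (power_utility p1) (power_utility p2) y t
    = - (exp (lambda r \<delta> \<theta> q1 * t) * y powr (q1 - 1)
         + growth_factor (lambda r \<delta> \<theta> q2) t * y powr (q2 - 1))"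
proof -
  have "(LINT \<tau>:{0..t}|lborel. dual_I r \<delta> \<theta> (power_utility p2) y \<tau>)
      = (LINT \<tau>:{0..t}|lborel. y powr (q2 - 1) * exp (lambda r \<delta> \<theta> q2 * \<tau>))"
    using assms by (intro set_lebesgue_integral_cong) (auto simp: dual_I_power_utility)
  also have "\<dots> = y powr (q2 - 1) * growth_factor (lambda r \<delta> \<theta> q2) t"
    using assms by (simp add: integral_exp_growth_factor)
  finally show ?thesis
    using assms by (simp add: dual_vy_def dual_I_power_utility)
qed

section \<open>The two-power equation and the optimal strategy\<close>

lemma two_power_sum_strict_antimono:
  fixes a b E G :: real
  assumes "a < 0" "b < 0" "E > 0" "G > 0" "0 < y" "y < z"
  shows "E * z powr a + G * z powr b < E * y powr a + G * y powr b"
  using assms by (intro add_strict_mono mult_strict_left_mono powr_less_mono2_neg) auto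

text \<open>Existence is the intermediate value theorem for a sum that decays to 0 at infinity;
  uniqueness is strict monotonicity.\<close>

lemma two_power_sum_solution:
  fixes a b E G x :: real
  assumes "a < 0" "b < 0" "E > 0" "G > 0" "x > 0"
  obtains y where "y > 0" "E * y powr a + G * y powr b = x"
    "\<And>z. z > 0 \<Longrightarrow> E * z powr a + G * z powr b = x \<Longrightarrow> z = y"
proof -
  let ?f = "\<lambda>y. E * y powr a + G * y powr b"
  have "(?f \<longlongrightarrow> E * 0 + G * 0) at_top"
    using assms by (intro tendsto_intros tendsto_neg_powr filterlim_ident)
  then have "eventually (\<lambda>y. ?f y < x) at_top"
    using assms by (intro order_tendstoD(2)) auto
  then obtain z where z: "z \<ge> 1" "?f z < x"
    by (metis (no_types, lifting) eventually_at_top_linorder linear)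
  \<comment> \<open>At \<open>s\<close> the first term alone equals \<open>x\<close>, so the whole
    sum exceeds \<open>x\<close> there.\<close>
  define s where "s = (x / E) powr (1 / a)"
  have s: "s > 0" "E * s powr a = x"
    using assms by (auto simp: s_def powr_powr)
  have "?f s > x"
    using s assms by simp
  have "s < z"
  proof (rule ccontr)
    assume "\<not> s < z"
    then have "s = z \<or> z < s" by linarith
    then show False
      using two_power_sum_strict_antimono[OF assms(1-4), of z s] z \<open>?f s > x\<close> by auto
  qed
  have "\<exists>y. s \<le> y \<and> y \<le> z \<and> ?f y = x"
    using s z \<open>s < z\<close> \<open>?f s > x\<close> by (intro IVT2') (auto intro!: continuous_intros)
  then obtain y where y: "s \<le> y" "?f y = x" by blast
  show thesis
  proof (rule that)
    show "y > 0" using s y by linarith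
    fix w :: real
    assume "w > 0" "?f w = x"
    then show "w = y"
      using two_power_sum_strict_antimono[OF assms(1-4), of w y]
        two_power_sum_strict_antimono[OF assms(1-4), of y w] y \<open>y > 0\<close>
      by (cases w y rule: linorder_cases) auto
  qed (fact y)
qed

text \<open>Unique solvability of the two-power equation identifies the definite description in
  \<open>dual_point\<close>. In the amount, multiplying the derivative by \<open>y\<close> restores
  both original powers, each weighted by its exponent.\<close>

lemma optimal_strategy_power_utility:
  fixes r \<delta> \<theta> :: real
  assumes "p1 < 1" "p2 < 1" "x > 0" "t > 0"
  defines "q1 \<equiv> p1 / (p1 - 1)" and "q2 \<equiv> p2 / (p2 - 1)"
  defines "E \<equiv> exp (lambda r \<delta> \<theta> q1 * t)" and "G \<equiv> growth_factor (lambda r \<delta> \<theta> q2) t"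
  defines "y \<equiv> dual_point r \<delta> \<theta> (power_utility p1) (power_utility p2) x t"
  shows "y > 0" "E * y powr (q1 - 1) + G * y powr (q2 - 1) = x"
    "optimal_amount r \<delta> \<theta> \<sigma> (power_utility p1) (power_utility p2) x t
       = \<theta> / \<sigma> * ((1 - q1) * (E * y powr (q1 - 1)) + (1 - q2) * (G * y powr (q2 - 1)))"
    "optimal_consumption r \<delta> \<theta> (power_utility p1) (power_utility p2) x t = y powr (q2 - 1)"
proof -
  let ?v = "\<lambda>z. dual_vy r \<delta> \<theta> (power_utility p1) (power_utility p2) z t"
  have v: "?v z = - (E * z powr (q1 - 1) + G * z powr (q2 - 1))" if "z > 0" for z
    using assms that by (simp add: dual_vy_power_utility)
  have q: "q1 - 1 < 0" "q2 - 1 < 0"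
    using assms by (auto simp: field_simps)
  have EG: "E > 0" "G > 0"
    using assms by (auto simp: growth_factor_pos)
  obtain y' where y': "y' > 0" "E * y' powr (q1 - 1) + G * y' powr (q2 - 1) = x"
    "\<And>z. z > 0 \<Longrightarrow> E * z powr (q1 - 1) + G * z powr (q2 - 1) = x \<Longrightarrow> z = y'"
    using two_power_sum_solution[OF q EG \<open>x > 0\<close>] by blast
  have "y = y'"
    unfolding y_def dual_point_def
  proof (rule the_equality)
    show "z = y'" if "z > 0 \<and> x = - ?v z" for z
      using that v[of z] by (intro y'(3)) auto
  qed (use y'(1,2) v[of y'] in auto)
  with y'(1,2) show y: "y > 0" "E * y powr (q1 - 1) + G * y powr (q2 - 1) = x"
    by simp_all
  show "optimal_consumption r \<delta> \<theta> (power_utility p1) (power_utility p2) x t = y powr (q2 - 1)"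
    using y assms by (simp add: optimal_consumption_def deriv_dual_power_utility)
  have D: "((\<lambda>z. - (E * z powr (q1 - 1) + G * z powr (q2 - 1))) has_real_derivative
      - (E * ((q1 - 1) * y powr (q1 - 1 - 1)) + G * ((q2 - 1) * y powr (q2 - 1 - 1)))) (at y)"
    using y by (intro DERIV_minus DERIV_add DERIV_cmult has_real_derivative_powr)
  have ev: "eventually (\<lambda>z. ?v z = - (E * z powr (q1 - 1) + G * z powr (q2 - 1))) (nhds y)"
    using eventually_nhds_in_open[of "{0<..}" y] y
    by (auto elim!: eventually_mono simp: v)
  have "(?v has_real_derivative
      - (E * ((q1 - 1) * y powr (q1 - 1 - 1)) + G * ((q2 - 1) * y powr (q2 - 1 - 1)))) (at y)"
    by (rule DERIV_cong_ev[OF refl ev refl, THEN iffD2, OF D])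
  then have d: "deriv ?v y
      = - (E * ((q1 - 1) * y powr (q1 - 1 - 1)) + G * ((q2 - 1) * y powr (q2 - 1 - 1)))"
    by (rule DERIV_imp_deriv)
  have e: "y powr (q1 - 1) = y * y powr (q1 - 1 - 1)" "y powr (q2 - 1) = y * y powr (q2 - 1 - 1)"
    using y powr_mult_base[of y "q1 - 1 - 1"] powr_mult_base[of y "q2 - 1 - 1"] by auto
  \<comment> \<open>With the powers abstracted to \<open>m\<close> and \<open>n\<close>, only a ring
    identity remains.\<close>
  have "y * - (E * ((q1 - 1) * m) + G * ((q2 - 1) * n))
      = (1 - q1) * (E * (y * m)) + (1 - q2) * (G * (y * n))" for m n
    by (simp add: algebra_simps)
  then have "y * deriv ?v y
      = (1 - q1) * (E * y powr (q1 - 1)) + (1 - q2) * (G * y powr (q2 - 1))"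
    unfolding d e .
  then show "optimal_amount r \<delta> \<theta> \<sigma> (power_utility p1) (power_utility p2) x t
       = \<theta> / \<sigma> * ((1 - q1) * (E * y powr (q1 - 1)) + (1 - q2) * (G * y powr (q2 - 1)))"
    by (simp add: optimal_amount_def y_def[symmetric] Let_def mult.assoc)
qed

section \<open>Asymptotics of the two-power equation\<close>

lemma two_power_sum_dominated_term:
  fixes a b x :: real and E G y :: "real \<Rightarrow> real"
  assumes "a < 0" "b < 0" "x > 0"
    and ev: "eventually (\<lambda>t. E t > 0 \<and> G t > 0 \<and> y t > 0
               \<and> E t * y t powr a + G t * y t powr b = x) F"
    and lim: "((\<lambda>t. E t * G t powr - (a / b)) \<longlongrightarrow> 0) F"
  shows "((\<lambda>t. E t * y t powr a) \<longlongrightarrow> 0) F" "((\<lambda>t. G t * y t powr b) \<longlongrightarrow> x) F"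
proof -
  have le: "eventually (\<lambda>t. E t * y t powr a \<le> x powr (a / b) * (E t * G t powr - (a / b))) F"
    using ev
  proof eventually_elim
    case (elim t)
    let ?w = "G t * y t powr b"
    have w: "?w > 0" "?w \<le> x"
      using elim mult_nonneg_nonneg[of "E t" "y t powr a"] by auto
    \<comment> \<open>This eliminates \<open>y t\<close>: the first term becomes
      \<open>E t * G t powr - (a / b)\<close> times a power of the second term, which is at most
      \<open>x\<close>.\<close>
    have "?w powr (a / b) = G t powr (a / b) * y t powr a"
      using elim \<open>b < 0\<close> by (simp add: powr_mult powr_powr)
    moreover have "G t powr - (a / b) * G t powr (a / b) = 1"
      using elim by (simp flip: powr_add)
    ultimately have "E t * y t powr a = E t * G t powr - (a / b) * ?w powr (a / b)"
      by (metis mult.assoc mult.right_neutral)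
    also have "\<dots> \<le> E t * G t powr - (a / b) * x powr (a / b)"
      using w elim \<open>a < 0\<close> \<open>b < 0\<close>
      by (intro mult_left_mono powr_mono2) (simp_all add: divide_nonpos_neg)
    finally show ?case by (simp add: mult_ac)
  qed
  have ge: "eventually (\<lambda>t. 0 \<le> E t * y t powr a) F"
    using ev by eventually_elim auto
  have "((\<lambda>t. x powr (a / b) * (E t * G t powr - (a / b))) \<longlongrightarrow> 0) F"
    using tendsto_mult[OF tendsto_const lim] by simp
  then show u: "((\<lambda>t. E t * y t powr a) \<longlongrightarrow> 0) F"
    by (rule tendsto_sandwich[OF ge le tendsto_const])
  have "((\<lambda>t. x - E t * y t powr a) \<longlongrightarrow> x) F"
    using tendsto_diff[OF tendsto_const u, of x] by simp
  moreover have "eventually (\<lambda>t. x - E t * y t powr a = G t * y t powr b) F"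
    using ev by eventually_elim auto
  ultimately show "((\<lambda>t. G t * y t powr b) \<longlongrightarrow> x) F"
    by (rule Lim_transform_eventually)
qed

text \<open>Pointwise convergence suffices by monotonicity. At a positive \<open>z\<close> below
  \<open>Y\<close> the limit sum exceeds \<open>x\<close>, hence so does the sum at time
  \<open>t\<close> eventually, which puts its root \<open>y t\<close> to the right of
  \<open>z\<close>; above \<open>Y\<close> the argument is symmetric.\<close>

lemma two_power_sum_root_tendsto:
  fixes a b x Y Einf Ginf :: real and E G y :: "real \<Rightarrow> real"
  assumes "a < 0" "b < 0" "Einf > 0" "Ginf > 0"
    and ev: "eventually (\<lambda>t. E t > 0 \<and> G t > 0 \<and> y t > 0
               \<and> E t * y t powr a + G t * y t powr b = x) F"
    and lim: "(E \<longlongrightarrow> Einf) F" "(G \<longlongrightarrow> Ginf) F"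
    and Y: "Y > 0" "Einf * Y powr a + Ginf * Y powr b = x"
  shows "(y \<longlongrightarrow> Y) F"
proof -
  have f: "((\<lambda>t. E t * z powr a + G t * z powr b) \<longlongrightarrow> Einf * z powr a + Ginf * z powr b) F" for z
    by (intro tendsto_intros lim)
  show ?thesis
  proof (rule order_tendstoI)
    fix z assume "z < Y"
    show "eventually (\<lambda>t. z < y t) F"
    proof (cases "z > 0")
      case True
      have "x < Einf * z powr a + Ginf * z powr b"
        using two_power_sum_strict_antimono[OF assms(1-4) True \<open>z < Y\<close>] Y by simp
      from order_tendstoD(1)[OF f this] ev show ?thesis
      proof eventually_elim
        case (elim t)
        then show ?case
          using two_power_sum_strict_antimono[OF assms(1,2), of "E t" "G t" "y t" z]
          by (cases "z" "y t" rule: linorder_cases) auto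
      qed
    next
      case False
      from ev show ?thesis
        by eventually_elim (use False in auto)
    qed
  next
    fix z assume "Y < z"
    have "Einf * z powr a + Ginf * z powr b < x"
      using two_power_sum_strict_antimono[OF assms(1-4) \<open>Y > 0\<close> \<open>Y < z\<close>] Y by simp
    from order_tendstoD(2)[OF f this] ev show "eventually (\<lambda>t. y t < z) F"
    proof eventually_elim
      case (elim t)
      then show ?case
        using two_power_sum_strict_antimono[OF assms(1,2), of "E t" "G t" z "y t"] Y \<open>Y < z\<close>
        by (cases "z" "y t" rule: linorder_cases) auto
    qed
  qed
qed

section \<open>Growth of the coefficients\<close>

lemma exp_decay:
  fixes c :: real
  assumes "c < 0"
  shows "((\<lambda>t. exp (c * t)) \<longlongrightarrow> 0) at_top"
  using assms
  by (intro filterlim_compose[OF exp_at_bot] filterlim_tendsto_neg_mult_at_bot[OF tendsto_const _ filterlim_ident])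

lemma growth_factor_tendsto_neg:
  assumes "l < 0"
  shows "(growth_factor l \<longlongrightarrow> - 1 / l) at_top"
proof -
  have "((\<lambda>t. (exp (l * t) - 1) / l) \<longlongrightarrow> (0 - 1) / l) at_top"
    using assms by (intro tendsto_intros exp_decay) auto
  with assms show ?thesis
    by (simp add: growth_factor_def[abs_def])
qed

text \<open>The growth factor is of order \<open>exp (l * t)\<close>, \<open>t\<close> or 1
  according to the sign of \<open>l\<close>. This serves the regime in which the terminal-wealth
  term dominates.\<close>

lemma growth_factor_subexponential:
  assumes "c < 0" "l + c < 0"
  shows "((\<lambda>t. growth_factor l t * exp (c * t)) \<longlongrightarrow> 0) at_top"
proof (cases "l = 0")
  case True
  have "((\<lambda>t. t * exp (c * t)) \<longlongrightarrow> 0) at_top"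
    using assms by real_asymp
  with True show ?thesis
    by (simp add: growth_factor_def)
next
  case False
  have "((\<lambda>t. (exp ((l + c) * t) - exp (c * t)) / l) \<longlongrightarrow> (0 - 0) / l) at_top"
    using assms False by (intro tendsto_intros exp_decay) auto
  with False show ?thesis
    by (simp add: growth_factor_def algebra_simps exp_add)
qed

text \<open>The counterpart for the regime in which the consumption term dominates:
  \<open>max l2 0\<close> is the exponential growth rate of the growth factor, also when that factor
  is linear or bounded.\<close>

lemma exp_growth_factor_powr_tendsto_0:
  assumes "k > 0" "l1 < k * max l2 0"
  shows "((\<lambda>t. exp (l1 * t) * growth_factor l2 t powr - k) \<longlongrightarrow> 0) at_top"
proof -
  consider "l2 > 0" | "l2 = 0" | "l2 < 0" by linarith
  then show ?thesis
  proof cases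
    case 1
    \<comment> \<open>Factoring \<open>exp (l2 * t)\<close> out of the growth factor leaves
      \<open>(1 - exp (- l2 * t)) / l2\<close>, which has a positive limit.\<close>
    have "((\<lambda>t. exp ((l1 - k * l2) * t) * ((1 - exp (- l2 * t)) / l2) powr - k)
        \<longlongrightarrow> 0 * ((1 - 0) / l2) powr - k) at_top"
      using 1 assms by (intro tendsto_intros exp_decay) auto
    then have "((\<lambda>t. exp ((l1 - k * l2) * t) * ((1 - exp (- l2 * t)) / l2) powr - k) \<longlongrightarrow> 0) at_top"
      by simp
    moreover have "eventually (\<lambda>t. exp ((l1 - k * l2) * t) * ((1 - exp (- l2 * t)) / l2) powr - k
        = exp (l1 * t) * growth_factor l2 t powr - k) at_top"
      using eventually_gt_at_top[of 0]
    proof eventually_elim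
      case (elim t)
      define h where "h = (1 - exp (- l2 * t)) / l2"
      have "h > 0"
        using 1 elim by (simp add: h_def)
      have "growth_factor l2 t = exp (l2 * t) * h"
        using 1 by (simp add: growth_factor_def h_def right_diff_distrib exp_minus)
      with \<open>h > 0\<close> have "growth_factor l2 t powr - k = exp (- k * l2 * t) * h powr - k"
        by (simp add: powr_mult exp_powr_real mult_ac)
      then show ?case
        unfolding h_def[symmetric] by (simp add: left_diff_distrib exp_diff exp_minus field_simps)
    qed
    ultimately show ?thesis
      by (rule Lim_transform_eventually)
  next
    case 2
    have "((\<lambda>t. exp (l1 * t) * t powr - k) \<longlongrightarrow> 0 * 0) at_top"
      using 2 assms by (intro tendsto_mult exp_decay tendsto_neg_powr filterlim_ident) auto
    with 2 show ?thesis by (simp add: growth_factor_def)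
  next
    case 3
    have "((\<lambda>t. exp (l1 * t) * growth_factor l2 t powr - k) \<longlongrightarrow> 0 * (- 1 / l2) powr - k) at_top"
      using 3 assms by (intro tendsto_mult tendsto_powr exp_decay growth_factor_tendsto_neg tendsto_const) auto
    then show ?thesis by simp
  qed
qed

section \<open>Sign and monotonicity of the rates\<close>

lemma lambda_eq:
  assumes "\<theta> \<noteq> 0"
  shows "lambda r \<delta> \<theta> q = \<theta>\<^sup>2 / 2 * q * (q - 1) - r * q + \<delta> * (q - 1)"
  using assms by (simp add: lambda_def const_beta_def const_alpha_def const_a_def
      power2_eq_square field_simps)

text \<open>In the decomposition \<open>*\<close> both terms that depend on \<open>q\<close>, one
  linear and one a multiple of \<open>1 / (1 - q)\<close>, are strictly decreasing.\<close>

lemma lambda_div_strict_antimono: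
  assumes "\<theta> \<noteq> 0" "r > 0" "q < q'" "q' < 1"
  shows "lambda r \<delta> \<theta> q' / (1 - q') < lambda r \<delta> \<theta> q / (1 - q)"
proof -
  have *: "lambda r \<delta> \<theta> q / (1 - q) = - (\<theta>\<^sup>2 / 2) * q + r - r / (1 - q) - \<delta>" if "q < 1" for q
    using that assms by (simp add: lambda_eq field_simps)
  have "r / (1 - q) < r / (1 - q')"
    using assms by (intro divide_strict_left_mono) auto
  moreover have "\<theta>\<^sup>2 / 2 * q < \<theta>\<^sup>2 / 2 * q'"
    using assms by (intro mult_strict_left_mono) auto
  ultimately show ?thesis
    using *[of q] *[of q'] assms by linarith
qed

lemma lambda_q_star:
  assumes "\<theta> \<noteq> 0" "\<delta> > 0"
  shows "lambda r \<delta> \<theta> (q_star r \<delta> \<theta>) = 0"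
proof -
  have "(const_alpha r \<delta> \<theta> - q_star r \<delta> \<theta>)\<^sup>2 = (const_alpha r \<delta> \<theta>)\<^sup>2 + 2 * \<delta> / \<theta>\<^sup>2"
    using assms by (simp add: q_star_def)
  with assms show ?thesis
    by (simp add: lambda_def const_beta_def const_a_def field_simps)
qed

lemma q_star_less_1:
  assumes "\<theta> \<noteq> 0" "\<delta> > 0"
  shows "q_star r \<delta> \<theta> < 1"
proof -
  have "2 * \<delta> / \<theta>\<^sup>2 > 0"
    using assms by simp
  then have "sqrt ((const_alpha r \<delta> \<theta>)\<^sup>2 + 2 * \<delta> / \<theta>\<^sup>2) > \<bar>const_alpha r \<delta> \<theta>\<bar>"
    by (intro real_less_rsqrt) auto
  then show ?thesis
    unfolding q_star_def by linarith
qed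

text \<open>Division by the positive number \<open>1 - q\<close> preserves the sign, and the
  resulting strictly decreasing ratio vanishes at \<open>q_star\<close>.\<close>

lemma lambda_sign:
  assumes "\<theta> \<noteq> 0" "\<delta> > 0" "r > 0" "q < 1"
  shows "lambda r \<delta> \<theta> q > 0 \<longleftrightarrow> q < q_star r \<delta> \<theta>"
    and "lambda r \<delta> \<theta> q < 0 \<longleftrightarrow> q > q_star r \<delta> \<theta>"
proof -
  have "q < q_star r \<delta> \<theta> \<Longrightarrow> lambda r \<delta> \<theta> q > 0" "q > q_star r \<delta> \<theta> \<Longrightarrow> lambda r \<delta> \<theta> q < 0"
    using lambda_div_strict_antimono[of \<theta> r q "q_star r \<delta> \<theta>" \<delta>]
      lambda_div_strict_antimono[of \<theta> r "q_star r \<delta> \<theta>" q \<delta>]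
      q_star_less_1[of \<theta> \<delta> r] lambda_q_star[of \<theta> \<delta> r] assms
    by (auto simp: zero_less_divide_iff divide_less_0_iff)
  with lambda_q_star[of \<theta> \<delta> r] assms
  show "lambda r \<delta> \<theta> q > 0 \<longleftrightarrow> q < q_star r \<delta> \<theta>" "lambda r \<delta> \<theta> q < 0 \<longleftrightarrow> q > q_star r \<delta> \<theta>"
    by (cases q "q_star r \<delta> \<theta>" rule: linorder_cases; force)+
qed

section \<open>The distant-horizon limits\<close>

theorem theorem2p3:
  fixes r \<delta> \<mu> \<sigma> \<theta> p1 p2 q1 q2 l1 l2 qs x :: real
    and A C :: "real \<Rightarrow> real \<Rightarrow> real"
  assumes "r > 0" and "\<delta> > 0" and "\<mu> > 0" and "\<sigma> > 0"
    and "\<theta> = (\<mu> - r) / \<sigma>" and "\<theta> \<noteq> 0"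
    and "p1 < 1" and "p2 < 1"
    and "q1 = p1 / (p1 - 1)" and "q2 = p2 / (p2 - 1)"
    and "l1 = lambda r \<delta> \<theta> q1" and "l2 = lambda r \<delta> \<theta> q2"
    and "qs = q_star r \<delta> \<theta>"
    and "A = optimal_amount r \<delta> \<theta> \<sigma> (power_utility p1) (power_utility p2)"
    and "C = optimal_consumption r \<delta> \<theta> (power_utility p1) (power_utility p2)"
    and "x > 0"
  shows
    "(q1 < qs \<or> q2 \<le> qs \<longrightarrow>
        ((\<lambda>t. A x t) \<longlongrightarrow> \<theta> / \<sigma> * (1 - min q1 q2) * x) at_top \<and>
        ((\<lambda>t. rate_R q1 q2 l1 l2 t * C x t) \<longlongrightarrow> x powr ((q2 - 1) / (min q1 q2 - 1))) at_top)
     \<and>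
     (q1 > qs \<and> q2 > qs \<longrightarrow>
        ((\<lambda>t. A x t) \<longlongrightarrow> \<theta> / \<sigma> * (1 - q2) * x) at_top \<and>
        ((\<lambda>t. C x t) \<longlongrightarrow> - l2 * x) at_top)
     \<and>
     (q1 = qs \<and> q2 > qs \<longrightarrow>
        (\<exists>Y>0. Y powr (q1 - 1) - 1 / l2 * Y powr (q2 - 1) = x \<and>
           (\<forall>y>0. y powr (q1 - 1) - 1 / l2 * y powr (q2 - 1) = x \<longrightarrow> y = Y) \<and>
           ((\<lambda>t. A x t) \<longlongrightarrow>
              \<theta> / \<sigma> * ((1 - q1) * Y powr (q1 - 1) - (1 - q2) * (1 / l2) * Y powr (q2 - 1))) at_top \<and>
           ((\<lambda>t. C x t) \<longlongrightarrow> Y powr (q2 - 1)) at_top))"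
proof -
  define E where "E = (\<lambda>t. exp (l1 * t))"
  define G where "G = growth_factor l2"
  define y where "y = dual_point r \<delta> \<theta> (power_utility p1) (power_utility p2) x"
  define u where "u = (\<lambda>t. E t * y t powr (q1 - 1))"
  define w where "w = (\<lambda>t. G t * y t powr (q2 - 1))"
  note strategy = optimal_strategy_power_utility
    [OF \<open>p1 < 1\<close> \<open>p2 < 1\<close> \<open>x > 0\<close>, of _ r \<delta> \<theta>, folded assms(9,10), folded assms(11,12)]
  have q: "q1 < 1" "q2 < 1"
    unfolding assms(9,10) using assms(7,8) by (auto simp: field_simps)
  then have k: "(q1 - 1) / (q2 - 1) > 0" "(q2 - 1) / (q1 - 1) > 0"
    by (auto intro: divide_neg_neg)
  have l1_sign: "l1 > 0 \<longleftrightarrow> q1 < qs" "l1 < 0 \<longleftrightarrow> q1 > qs" "l1 = 0 \<longleftrightarrow> q1 = qs"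
    and l2_sign: "l2 > 0 \<longleftrightarrow> q2 < qs" "l2 < 0 \<longleftrightarrow> q2 > qs" "l2 = 0 \<longleftrightarrow> q2 = qs"
    using lambda_sign[of \<theta> \<delta> r q1] lambda_sign[of \<theta> \<delta> r q2] assms q
    by (smt (verit))+
  have ev: "eventually (\<lambda>t. E t > 0 \<and> G t > 0 \<and> y t > 0
      \<and> E t * y t powr (q1 - 1) + G t * y t powr (q2 - 1) = x) at_top"
    using eventually_gt_at_top[of 0]
    by eventually_elim (use strategy(1,2) in \<open>auto simp: E_def G_def y_def growth_factor_pos\<close>)
  \<comment> \<open>With the two terms exchanged, the domination lemma can also make
    \<open>w\<close> vanish.\<close>
  then have ev': "eventually (\<lambda>t. G t > 0 \<and> E t > 0 \<and> y t > 0
      \<and> G t * y t powr (q2 - 1) + E t * y t powr (q1 - 1) = x) at_top"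
    by eventually_elim (auto simp: add.commute)
  have A: "eventually (\<lambda>t. A x t = \<theta> / \<sigma> * ((1 - q1) * u t + (1 - q2) * w t)) at_top"
    using eventually_gt_at_top[of 0]
    by eventually_elim (use strategy(3) in \<open>auto simp: E_def G_def y_def u_def w_def assms(14)\<close>)
  have C: "eventually (\<lambda>t. C x t = y t powr (q2 - 1)) at_top"
    using eventually_gt_at_top[of 0]
    by eventually_elim (use strategy(4) in \<open>auto simp: y_def assms(15)\<close>)
  have A_lim: "((\<lambda>t. A x t) \<longlongrightarrow> \<theta> / \<sigma> * ((1 - q1) * m + (1 - q2) * n)) at_top"
    if "(u \<longlongrightarrow> m) at_top" "(w \<longlongrightarrow> n) at_top" for m n
    by (subst tendsto_cong[OF A]) (intro tendsto_intros that)
  \<comment> \<open>For equal exponents \<open>A x t\<close> is a fixed multiple of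
    \<open>u t + w t = x\<close>.\<close>
  have A_eq: "((\<lambda>t. A x t) \<longlongrightarrow> \<theta> / \<sigma> * (1 - q2) * x) at_top" if "q1 = q2"
  proof -
    have "eventually (\<lambda>t. \<theta> / \<sigma> * (1 - q2) * x = A x t) at_top"
      using A ev
    proof eventually_elim
      case (elim t)
      then have "u t + w t = x"
        by (simp add: u_def w_def)
      with elim that show ?case
        by (simp add: distrib_left[symmetric] mult.assoc)
    qed
    then show ?thesis
      by (rule Lim_transform_eventually[OF tendsto_const])
  qed
  have ratio: "(q1 - 1) / (q2 - 1) = (1 - q1) / (1 - q2)"
    using minus_divide_divide[of "1 - q1" "1 - q2"] by simp
  \<comment> \<open>Here and in \<open>order'\<close>, monotonicity of
    \<open>\<lambda>(q)/(1 - q)\<close> is cross-multiplied into a comparison of \<open>l1\<close>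
    with \<open>l2\<close> times the exponent ratio.\<close>
  have order: "l2 * ((q1 - 1) / (q2 - 1)) < l1" if "q1 < q2"
  proof -
    have "l2 / (1 - q2) < l1 / (1 - q1)"
      unfolding assms(11,12) using lambda_div_strict_antimono that q assms(1,6) by blast
    with q show ?thesis
      by (simp add: ratio pos_less_divide_eq)
  qed
  have order': "l1 < (q1 - 1) / (q2 - 1) * l2" if "q2 < q1"
  proof -
    have "l1 / (1 - q1) < l2 / (1 - q2)"
      unfolding assms(11,12) using lambda_div_strict_antimono that q assms(1,6) by blast
    with q show ?thesis
      by (simp add: ratio pos_divide_less_eq mult.commute)
  qed

  have case1_less: "((\<lambda>t. A x t) \<longlongrightarrow> \<theta> / \<sigma> * (1 - min q1 q2) * x) at_top \<and>
      ((\<lambda>t. rate_R q1 q2 l1 l2 t * C x t) \<longlongrightarrow> x powr ((q2 - 1) / (min q1 q2 - 1))) at_top"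
    if "q1 < q2" "q1 < qs"
  proof -
    \<comment> \<open>The rate for which \<open>exp (c * t)\<close> is
      \<open>E t powr - ((q2 - 1) / (q1 - 1))\<close>.\<close>
    define c where "c = - (l1 * ((q2 - 1) / (q1 - 1)))"
    have "l1 > 0" using l1_sign that by simp
    then have "c < 0" unfolding c_def using mult_pos_pos k(2) by (simp only: neg_less_0_iff_less)
    moreover have "l2 + c < 0"
      unfolding c_def using order[OF that(1)] k q by (simp add: field_simps)
    ultimately have "((\<lambda>t. G t * exp (c * t)) \<longlongrightarrow> 0) at_top"
      unfolding G_def by (intro growth_factor_subexponential)
    then have "((\<lambda>t. G t * E t powr - ((q2 - 1) / (q1 - 1))) \<longlongrightarrow> 0) at_top"
      by (simp add: E_def exp_powr_real c_def mult_ac)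
    from two_power_sum_dominated_term[OF _ _ \<open>x > 0\<close> ev' this]
    have lim: "(w \<longlongrightarrow> 0) at_top" "(u \<longlongrightarrow> x) at_top"
      using q by (auto simp: u_def w_def)
    \<comment> \<open>This power turns \<open>y t powr (q1 - 1)\<close> into the consumption rate
      and \<open>E t\<close> into \<open>rate_R\<close>.\<close>
    have "((\<lambda>t. u t powr ((q2 - 1) / (q1 - 1))) \<longlongrightarrow> x powr ((q2 - 1) / (q1 - 1))) at_top"
      using \<open>x > 0\<close> by (intro tendsto_powr lim tendsto_const) auto
    moreover have "eventually (\<lambda>t. u t powr ((q2 - 1) / (q1 - 1)) = rate_R q1 q2 l1 l2 t * C x t) at_top"
      using C ev
    proof eventually_elim
      case (elim t)
      have "u t powr ((q2 - 1) / (q1 - 1)) = exp ((q2 - 1) / (q1 - 1) * l1 * t) * y t powr (q2 - 1)"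
        using elim q by (simp add: u_def E_def powr_mult powr_powr exp_powr_real mult_ac)
      with elim that show ?case by (simp add: rate_R_def)
    qed
    ultimately have "((\<lambda>t. rate_R q1 q2 l1 l2 t * C x t) \<longlongrightarrow> x powr ((q2 - 1) / (q1 - 1))) at_top"
      by (rule Lim_transform_eventually)
    with A_lim[OF lim(2,1)] that show ?thesis by (simp add: mult.assoc)
  qed

  \<comment> \<open>Used both when \<open>l2\<close> is nonnegative, with \<open>order'\<close>, and
    when both rates are negative, where the bound on \<open>l1\<close> is 0.\<close>
  have w_dominates: "(u \<longlongrightarrow> 0) at_top \<and> (w \<longlongrightarrow> x) at_top" if "l1 < (q1 - 1) / (q2 - 1) * max l2 0"
    using two_power_sum_dominated_term[OF _ _ \<open>x > 0\<close> ev]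
      exp_growth_factor_powr_tendsto_0[OF k(1) that] q
    by (auto simp: u_def w_def E_def G_def)

  have case1_greater: "((\<lambda>t. A x t) \<longlongrightarrow> \<theta> / \<sigma> * (1 - min q1 q2) * x) at_top \<and>
      ((\<lambda>t. rate_R q1 q2 l1 l2 t * C x t) \<longlongrightarrow> x powr ((q2 - 1) / (min q1 q2 - 1))) at_top"
    if "q2 < q1" "q2 \<le> qs"
  proof -
    have "max l2 0 = l2"
      using that l2_sign by linarith
    with order'[OF that(1)] have lim: "(u \<longlongrightarrow> 0) at_top" "(w \<longlongrightarrow> x) at_top"
      using w_dominates by auto
    \<comment> \<open>Here \<open>rate_R\<close> is \<open>G\<close>, so its product with
      consumption is exactly \<open>w\<close>; the exponent of \<open>x\<close> in the claim is
      1.\<close>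
    have "eventually (\<lambda>t. w t = rate_R q1 q2 l1 l2 t * C x t) at_top"
      using C by eventually_elim (use that in \<open>auto simp: w_def G_def rate_R_def\<close>)
    with lim(2) have "((\<lambda>t. rate_R q1 q2 l1 l2 t * C x t) \<longlongrightarrow> x) at_top"
      by (rule Lim_transform_eventually)
    with A_lim[OF lim] that q \<open>x > 0\<close> show ?thesis by (simp add: mult.assoc)
  qed

  have case1_eq: "((\<lambda>t. A x t) \<longlongrightarrow> \<theta> / \<sigma> * (1 - min q1 q2) * x) at_top \<and>
      ((\<lambda>t. rate_R q1 q2 l1 l2 t * C x t) \<longlongrightarrow> x powr ((q2 - 1) / (min q1 q2 - 1))) at_top"
    if "q1 = q2"
  proof -
    have "eventually (\<lambda>t. x = rate_R q1 q2 l1 l2 t * C x t) at_top"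
      using C ev by eventually_elim (use that in \<open>auto simp: E_def G_def rate_R_def distrib_right\<close>)
    then have "((\<lambda>t. rate_R q1 q2 l1 l2 t * C x t) \<longlongrightarrow> x) at_top"
      by (rule Lim_transform_eventually[OF tendsto_const])
    with A_eq that q \<open>x > 0\<close> show ?thesis by simp
  qed

  have case2: "((\<lambda>t. A x t) \<longlongrightarrow> \<theta> / \<sigma> * (1 - q2) * x) at_top \<and> ((\<lambda>t. C x t) \<longlongrightarrow> - l2 * x) at_top"
    if "q1 > qs" "q2 > qs"
  proof -
    have l: "l1 < 0" "l2 < 0"
      using that l1_sign l2_sign by auto
    then have lim: "(u \<longlongrightarrow> 0) at_top" "(w \<longlongrightarrow> x) at_top"
      using w_dominates by auto
    \<comment> \<open>Consumption is \<open>w t / G t\<close>, and \<open>G\<close> converges to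
      \<open>- 1 / l2\<close>.\<close>
    have "((\<lambda>t. w t / G t) \<longlongrightarrow> x / (- 1 / l2)) at_top"
      unfolding G_def using l by (intro tendsto_divide lim growth_factor_tendsto_neg) auto
    moreover have "eventually (\<lambda>t. w t / G t = C x t) at_top"
      using C ev by eventually_elim (auto simp: w_def)
    ultimately have "((\<lambda>t. C x t) \<longlongrightarrow> x / (- 1 / l2)) at_top"
      by (rule Lim_transform_eventually)
    with A_lim[OF lim] show ?thesis by (simp add: mult_ac)
  qed

  have case3: "\<exists>Y>0. Y powr (q1 - 1) - 1 / l2 * Y powr (q2 - 1) = x \<and>
           (\<forall>y>0. y powr (q1 - 1) - 1 / l2 * y powr (q2 - 1) = x \<longrightarrow> y = Y) \<and>
           ((\<lambda>t. A x t) \<longlongrightarrow>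
              \<theta> / \<sigma> * ((1 - q1) * Y powr (q1 - 1) - (1 - q2) * (1 / l2) * Y powr (q2 - 1))) at_top \<and>
           ((\<lambda>t. C x t) \<longlongrightarrow> Y powr (q2 - 1)) at_top"
    if "q1 = qs" "q2 > qs"
  proof -
    have l: "l1 = 0" "l2 < 0"
      using that l1_sign l2_sign by auto
    have neg: "q1 - 1 < 0" "q2 - 1 < 0" and "- 1 / l2 > 0"
      using q l by (auto simp: zero_less_divide_iff)
    \<comment> \<open>The coefficients are the limits of \<open>E\<close>, which is constantly 1,
      and of \<open>G\<close>.\<close>
    obtain Y where Y: "Y > 0" "1 * Y powr (q1 - 1) + (- 1 / l2) * Y powr (q2 - 1) = x"
      "\<And>z. z > 0 \<Longrightarrow> 1 * z powr (q1 - 1) + (- 1 / l2) * z powr (q2 - 1) = x \<Longrightarrow> z = Y"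
      using two_power_sum_solution[OF neg zero_less_one \<open>- 1 / l2 > 0\<close> \<open>x > 0\<close>] by blast
    have Elim: "(E \<longlongrightarrow> 1) at_top" and Glim: "(G \<longlongrightarrow> - 1 / l2) at_top"
      using l growth_factor_tendsto_neg by (simp_all add: E_def G_def)
    have "(y \<longlongrightarrow> Y) at_top"
      by (rule two_power_sum_root_tendsto[OF neg zero_less_one \<open>- 1 / l2 > 0\<close> ev Elim Glim Y(1,2)])
    then have ylim: "((\<lambda>t. y t powr c) \<longlongrightarrow> Y powr c) at_top" for c
      using Y(1) by (intro tendsto_powr tendsto_const) auto
    have "(u \<longlongrightarrow> 1 * Y powr (q1 - 1)) at_top" "(w \<longlongrightarrow> (- 1 / l2) * Y powr (q2 - 1)) at_top"
      unfolding u_def w_def by (intro tendsto_mult Elim Glim ylim)+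
    from A_lim[OF this]
    have "((\<lambda>t. A x t) \<longlongrightarrow>
        \<theta> / \<sigma> * ((1 - q1) * Y powr (q1 - 1) - (1 - q2) * (1 / l2) * Y powr (q2 - 1))) at_top"
      by (simp add: algebra_simps)
    moreover have "((\<lambda>t. C x t) \<longlongrightarrow> Y powr (q2 - 1)) at_top"
      by (subst tendsto_cong[OF C]) (rule ylim)
    moreover have "\<forall>z>0. z powr (q1 - 1) - 1 / l2 * z powr (q2 - 1) = x \<longrightarrow> z = Y"
      by (intro allI impI Y(3)) simp_all
    moreover have "Y powr (q1 - 1) - 1 / l2 * Y powr (q2 - 1) = x"
      using Y(2) by simp
    ultimately show ?thesis
      using Y(1) by blast
  qed

  show ?thesis
  proof (intro conjI impI)
    assume *: "q1 < qs \<or> q2 \<le> qs"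
    \<comment> \<open>If \<open>q1 < q2\<close>, either alternative of \<open>*\<close> gives
      \<open>q1 < qs\<close>; if \<open>q2 < q1\<close>, either gives
      \<open>q2 \<le> qs\<close>.\<close>
    consider "q1 = q2" | "q1 < q2" "q1 < qs" | "q2 < q1" "q2 \<le> qs"
      using * by linarith
    then show "((\<lambda>t. A x t) \<longlongrightarrow> \<theta> / \<sigma> * (1 - min q1 q2) * x) at_top"
      "((\<lambda>t. rate_R q1 q2 l1 l2 t * C x t) \<longlongrightarrow> x powr ((q2 - 1) / (min q1 q2 - 1))) at_top"
      using case1_eq case1_less case1_greater by (cases; simp)+
  qed (use case2 case3 in auto)
qed

end
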